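(* Let $n,m\ge 1$ be integers and let $\mathbf{W}\in\mathbb{C}^{m\times m}$ be Hermitian, with singular values $\sigma_1(\mathbf{W}),\dots,\sigma_m(\mathbf{W})$. Let $\mathbb{M}_{n,m}\in\mathbb{C}^{mn\times m(n+1)}$ be the block matrix with $n$ block rows and $n+1$ block columns of $m\times m$ blocks whose $(j,j)$ block is the identity $\mathbf{I}$ and whose $(j,j+1)$ block is $\mathbf{W}$ for $1\le j\le n$, all other blocks being zero, and let $\mathbb{A}_{n,m}=\mathbb{M}_{n,m}\mathbb{M}_{n,m}^*$. For $\sigma_{\max}(\mathbf{W})\le 1$, an upper bound on the generalized determinant is $$S(\mathbb{M}_{n,m})=\sqrt{|\det(\mathbb{A}_{n,m})|}\le \begin{cases}\left(\dfrac{1}{\sqrt{\min_{j\in\{1,\dots,m\}}(1-\sigma_j(\mathbf{W})^2)}}\right)^{m} & \sigma_{\max}(\mathbf{W})<1,\\[3mm] \left(\sqrt{n+1}\right)^m & \sigma_{\max}(\mathbf{W})=1,\\[1mm] n^{m/2}\,\sigma_{\max}(\mathbf{W})^{nm} & \sigma_{\max}(\mathbf{W})>1.\end{cases}$$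
   Context: $*$ denotes the Hermitian transpose and $\sigma_{\max}(\mathbf{W})$ is the largest singular value of $\mathbf{W}$. For a matrix $\mathbb{M}$ with at least as many columns as rows, the generalized determinant is $S(\mathbb{M}):=\sqrt{|\det(\mathbb{M}\mathbb{M}^* )|}$, the product of its singular values (as many as there are rows). *)

theory Defs
  imports "Jordan_Normal_Form.Schur_Decomposition"
begin

(* mat_adjoint is the conjugate transpose *)
definition hermitian_mat :: "complex mat \<Rightarrow> bool" where
  "hermitian_mat A \<longleftrightarrow> square_mat A \<and> mat_adjoint A = A"

(* Intended for matrices with at least as many columns as rows: A A^* then yields exactly
   the singular values, one per row, with multiplicity. The eigenvalues of A A^* are real
   and nonnegative, so Re only changes the type. Listed in decreasing order. *)
definition singular_values :: "complex mat \<Rightarrow> real list" where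
  "singular_values A =
     rev (sorted_list_of_multiset
       (image_mset (\<lambda>z. sqrt (Re z)) (proots (char_poly (A * mat_adjoint A)))))"

lemma length_singular_values: "length (singular_values A) = dim_row A"
proof -
  let ?B = "A * mat_adjoint A"
  have "?B \<in> carrier_mat (dim_row A) (dim_row A)"
    by (intro carrier_matI) (simp_all add: mat_adjoint_def)
  then have "degree (char_poly ?B) = dim_row A"
    using degree_monic_char_poly by blast
  then have s: "size (proots (char_poly ?B)) = dim_row A"
    by (simp only: size_proots_complex)
  have l: "length (sorted_list_of_multiset X) = size X" for X :: "real multiset"
    by (subst size_mset[symmetric]) (simp only: mset_sorted_list_of_multiset)
  show ?thesis
    by (simp only: singular_values_def length_rev l size_image_mset s)
qed

(* 1-based: j ranges over {1..dim_row A} *)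
definition singular_value :: "complex mat \<Rightarrow> nat \<Rightarrow> real" where
  "singular_value A j = singular_values A ! (j - 1)"

definition sigma_max :: "complex mat \<Rightarrow> real" where
  "sigma_max A = Max (singular_value A ` {1..dim_row A})"

definition gen_det :: "complex mat \<Rightarrow> real" where
  "gen_det M = sqrt (cmod (det (M * mat_adjoint M)))"

(* n block rows and n + 1 block columns of m x m blocks: the 0-based entry (i, j) is entry
   (i mod m, j mod m) of block (i div m, j div m). *)
definition block_M :: "nat \<Rightarrow> nat \<Rightarrow> complex mat \<Rightarrow> complex mat" where
  "block_M n m W = mat (m * n) (m * (n + 1)) (\<lambda>(i, j).
     if j div m = i div m then 1\<^sub>m m $$ (i mod m, j mod m)
     else if j div m = i div m + 1 then W $$ (i mod m, j mod m)
     else 0)"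

definition block_A :: "nat \<Rightarrow> nat \<Rightarrow> complex mat \<Rightarrow> complex mat" where
  "block_A n m W = block_M n m W * mat_adjoint (block_M n m W)"

end

theory Submission
  imports Defs
begin

text \<open>Let \<open>T\<close> consist of the first \<open>n\<close> block columns of \<open>M\<close>; it is unipotent. Solving \<open>T C = b\<close> for
  the last block column \<open>b\<close> gives \<open>M = T [I | C]\<close>, so \<open>det (M M*) = det (I + C C*)\<close>, which is
  \<open>det (I + C* C)\<close> by Sylvester's identity. Since \<open>W\<close> is Hermitian, \<open>I + C* C\<close> is the geometric sum
  of the powers \<open>(W W*)^k\<close>, \<open>k \<le> n\<close>. Triangularising \<open>W W*\<close>, whose eigenvalues are the squares
  of the singular values of \<open>W\<close>, shows that \<open>det (M M*)\<close> is the product over \<open>j\<close> of the sums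
  \<open>1 + \<sigma>\<^sub>j^2 + \<dots> + \<sigma>\<^sub>j^(2n)\<close>. Each factor is at most \<open>1 / (1 - \<sigma>\<^sub>j^2)\<close> or \<open>n + 1\<close>.\<close>

section \<open>Adjoints and Sylvester's determinant identity\<close>

lemma dim_mat_adjoint [simp]:
  "dim_row (mat_adjoint A) = dim_col A" "dim_col (mat_adjoint A) = dim_row A"
  by (simp_all add: mat_adjoint_def)

lemma mat_adjoint_carrier [simp]:
  "A \<in> carrier_mat r c \<Longrightarrow> mat_adjoint A \<in> carrier_mat c r"
  by (intro carrier_matI) auto

lemma index_mat_adjoint [simp]:
  fixes A :: "complex mat"
  assumes "i < dim_col A" "j < dim_row A"
  shows "mat_adjoint A $$ (i, j) = cnj (A $$ (j, i))"
  using assms by (simp add: mat_adjoint_def mat_of_rows_index)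

lemma index_mult_mat_sum:
  assumes "A \<in> carrier_mat r k" "B \<in> carrier_mat k c" "i < r" "j < c"
  shows "(A * B) $$ (i, j) = (\<Sum>l<k. A $$ (i, l) * B $$ (l, j))"
  using assms by (simp add: scalar_prod_def atLeast0LessThan)

lemma mat_adjoint_mult:
  fixes A :: "complex mat"
  assumes A: "A \<in> carrier_mat r k" and B: "B \<in> carrier_mat k c"
  shows "mat_adjoint (A * B) = mat_adjoint B * mat_adjoint A"
proof (rule eq_matI)
  fix i j assume "i < dim_row (mat_adjoint B * mat_adjoint A)" "j < dim_col (mat_adjoint B * mat_adjoint A)"
  then have ij: "i < c" "j < r"
    using A B by auto
  have "mat_adjoint (A * B) $$ (i, j) = (\<Sum>l<k. cnj (A $$ (j, l)) * cnj (B $$ (l, i)))"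
    using A B ij by (simp add: index_mult_mat_sum[OF A B] del: index_mult_mat(1))
  also have "\<dots> = (\<Sum>l<k. mat_adjoint B $$ (i, l) * mat_adjoint A $$ (l, j))"
    using A B ij by (intro sum.cong) (auto simp: mult.commute)
  also have "\<dots> = (mat_adjoint B * mat_adjoint A) $$ (i, j)"
    by (rule index_mult_mat_sum[symmetric]) (use A B ij in auto)
  finally show "mat_adjoint (A * B) $$ (i, j) = (mat_adjoint B * mat_adjoint A) $$ (i, j)" .
qed (use A B in simp_all)

text \<open>Multiplying F = [I, -A; B, I] by the unipotent U = [I, A; 0, I] clears the upper right
  block from either side. F U has the diagonal blocks I and I + B A, while U F has I + A B and I.
  Both products have the same determinant.\<close>

lemma det_one_plus_mult_commute:
  fixes A :: "'a :: idom mat"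
  assumes A: "A \<in> carrier_mat r c" and B: "B \<in> carrier_mat c r"
  shows "det (1\<^sub>m r + A * B) = det (1\<^sub>m c + B * A)"
proof -
  let ?F = "four_block_mat (1\<^sub>m r) (- A) B (1\<^sub>m c)"
  let ?U = "four_block_mat (1\<^sub>m r) A (0\<^sub>m c r) (1\<^sub>m c)"
  have F: "?F \<in> carrier_mat (r + c) (r + c)" and U: "?U \<in> carrier_mat (r + c) (r + c)"
    using A B by auto
  have "det ?U = 1"
    using A by (subst det_four_block_mat_lower_left_zero[of _ r _ c]) auto
  moreover have "?F * ?U = four_block_mat (1\<^sub>m r) (0\<^sub>m r c) B (1\<^sub>m c + B * A)"
    using A B
    by (subst mult_four_block_mat[of _ r r _ c _ c])
       (auto intro!: cong_four_block_mat simp: uminus_l_inv_mat comm_add_mat[of _ c c])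
  then have "det (?F * ?U) = det (1\<^sub>m c + B * A)"
    using A B by (simp add: det_four_block_mat_upper_right_zero[of _ r _ c])
  moreover have "?U * ?F = four_block_mat (1\<^sub>m r + A * B) (0\<^sub>m r c) B (1\<^sub>m c)"
    using A B
    by (subst mult_four_block_mat[of _ r r _ c _ c])
       (auto intro!: cong_four_block_mat simp: uminus_l_inv_mat)
  then have "det (?U * ?F) = det (1\<^sub>m r + A * B)"
    using A B by (simp add: det_four_block_mat_upper_right_zero[of _ r _ c])
  ultimately show ?thesis
    using det_mult[OF F U] det_mult[OF U F] by simp
qed

section \<open>Powers of a matrix\<close>

lemma pow_mat_Suc_left:
  fixes A :: "'a :: semiring_1 mat"
  assumes A: "A \<in> carrier_mat m m"
  shows "A ^\<^sub>m Suc k = A * A ^\<^sub>m k"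
proof (induction k)
  case 0
  then show ?case using A by simp
next
  case (Suc k)
  have "A ^\<^sub>m Suc (Suc k) = (A * A ^\<^sub>m k) * A"
    using Suc by simp
  also have "\<dots> = A * (A ^\<^sub>m k * A)"
    using A by (intro assoc_mult_mat) auto
  finally show ?case by simp
qed

lemma pow_mat_mult_pow_mat_same:
  fixes A :: "'a :: semiring_1 mat"
  assumes A: "A \<in> carrier_mat m m"
  shows "A ^\<^sub>m k * A ^\<^sub>m k = (A * A) ^\<^sub>m k"
proof (induction k)
  case 0
  then show ?case using A by simp
next
  case (Suc k)
  define B where "B = A ^\<^sub>m k"
  have B: "B \<in> carrier_mat m m" using A by (simp add: B_def)
  have comm: "A * B = B * A"
    using pow_mat_Suc_left[OF A, of k] by (simp add: B_def)
  have "A ^\<^sub>m Suc k * A ^\<^sub>m Suc k = (B * A) * (B * A)"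
    by (simp add: B_def)
  \<comment> \<open>Reassociating exposes the inner \<open>A * B\<close>, where the commutation of
    \<open>A\<close> with its power applies.\<close>
  also have "\<dots> = B * (A * B) * A"
    using A B by (simp add: assoc_mult_mat[of _ m m _ m _ m])
  also have "\<dots> = (B * B) * (A * A)"
    unfolding comm using A B by (simp add: assoc_mult_mat[of _ m m _ m _ m])
  finally show ?case by (simp add: B_def Suc)
qed

lemma mat_adjoint_pow_mat:
  fixes A :: "complex mat"
  assumes A: "A \<in> carrier_mat m m" and h: "mat_adjoint A = A"
  shows "mat_adjoint (A ^\<^sub>m k) = A ^\<^sub>m k"
proof (induction k)
  case 0
  show ?case using A by (intro eq_matI) auto
next
  case (Suc k)
  \<comment> \<open>The adjoint reverses the factors: \<open>pow_mat\<close> appends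
    \<open>A\<close> on the right, so it reappears on the left.\<close>
  have "mat_adjoint (A ^\<^sub>m Suc k) = mat_adjoint A * mat_adjoint (A ^\<^sub>m k)"
    using A by (simp add: mat_adjoint_mult[of _ m m _ m])
  also have "\<dots> = A ^\<^sub>m Suc k"
    by (simp only: h Suc pow_mat_Suc_left[OF A])
  finally show ?case .
qed

section \<open>Geometric sums of matrix powers, and the spectrum of a matrix times its
  adjoint\<close>

fun geom_mat :: "nat \<Rightarrow> 'a :: semiring_1 mat \<Rightarrow> 'a mat" where
  "geom_mat 0 A = 1\<^sub>m (dim_row A)"
| "geom_mat (Suc n) A = geom_mat n A + A ^\<^sub>m Suc n"

lemma geom_mat_carrier [simp]:
  "A \<in> carrier_mat m m \<Longrightarrow> geom_mat n A \<in> carrier_mat m m"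
  by (induction n) auto

lemma index_geom_mat:
  assumes "A \<in> carrier_mat m m" "i < m" "j < m"
  shows "geom_mat n A $$ (i, j) = (\<Sum>k\<le>n. (A ^\<^sub>m k) $$ (i, j))"
proof (induction n)
  case (Suc n)
  have "geom_mat (Suc n) A $$ (i, j) = geom_mat n A $$ (i, j) + (A ^\<^sub>m Suc n) $$ (i, j)"
    using assms pow_carrier_mat[OF assms(1), of "Suc n"] unfolding geom_mat.simps
    by (intro index_add_mat) auto
  then show ?case using Suc by simp
qed (use assms in simp)

text \<open>Conjugation is additive and respects powers, so the same witnesses \<open>P\<close>,
  \<open>Q\<close> serve for the whole sum. This carries the determinant over to a Schur
  form.\<close>

lemma similar_mat_wit_geom_mat:
  fixes A :: "complex mat"
  assumes A: "A \<in> carrier_mat m m" and sim: "similar_mat_wit A B P Q"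
  shows "similar_mat_wit (geom_mat n A) (geom_mat n B) P Q"
proof (rule similar_mat_witI[of _ _ m])
  note w = similar_mat_witD2[OF A sim]
  show "P * Q = 1\<^sub>m m" "Q * P = 1\<^sub>m m" "P \<in> carrier_mat m m" "Q \<in> carrier_mat m m"
    "geom_mat n A \<in> carrier_mat m m" "geom_mat n B \<in> carrier_mat m m"
    using w by auto
  show "geom_mat n A = P * geom_mat n B * Q"
  proof (induction n)
    case 0
    show ?case using w(1,4-7) by simp
  next
    case (Suc n)
    have c: "geom_mat n B \<in> carrier_mat m m" "B ^\<^sub>m Suc n \<in> carrier_mat m m"
      using w by (auto simp del: pow_mat.simps)
    have "P * geom_mat (Suc n) B * Q = P * geom_mat n B * Q + P * B ^\<^sub>m Suc n * Q"
      using c w(6,7)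
      by (simp add: mult_add_distrib_mat[of _ m m _ m] add_mult_distrib_mat[of _ m m _ _ m]
          del: pow_mat.simps)
    then show ?case
      by (simp only: geom_mat.simps Suc similar_mat_wit_pow_id[OF sim])
  qed
qed

text \<open>In the sum for entry (i, j), the left factor vanishes for l < i and the right one for l
  > j. No term survives when j < i, and only l = i survives on the diagonal.\<close>

lemma upper_triangular_mult:
  fixes A B :: "'a :: semiring_1 mat"
  assumes A: "A \<in> carrier_mat m m" and B: "B \<in> carrier_mat m m"
    and "upper_triangular A" "upper_triangular B"
  shows "upper_triangular (A * B)"
    and "i < m \<Longrightarrow> (A * B) $$ (i, i) = A $$ (i, i) * B $$ (i, i)"
proof -
  have zA: "A $$ (i, l) = 0" if "l < i" "i < m" for i l
    using assms that by auto
  have zB: "B $$ (l, j) = 0" if "j < l" "l < m" for j l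
    using assms that by auto
  show "upper_triangular (A * B)"
  proof (rule upper_triangularI)
    fix j i assume "j < i" "i < dim_row (A * B)"
    then have ij: "j < i" "i < m" using A by auto
    then have "(A * B) $$ (i, j) = (\<Sum>l<m. A $$ (i, l) * B $$ (l, j))"
      using A B by (intro index_mult_mat_sum[of _ m m _ m]) auto
    also have "\<dots> = 0"
    proof (rule sum.neutral, rule ballI)
      fix l assume "l \<in> {..<m}"
      then show "A $$ (i, l) * B $$ (l, j) = 0"
        using ij zA[of l i] zB[of j l] by (cases "l < i") auto
    qed
    finally show "(A * B) $$ (i, j) = 0" .
  qed
  assume i: "i < m"
  have "(A * B) $$ (i, i) = (\<Sum>l<m. A $$ (i, l) * B $$ (l, i))"
    using A B i by (intro index_mult_mat_sum) auto
  also have "\<dots> = (\<Sum>l<m. if l = i then A $$ (i, i) * B $$ (i, i) else 0)"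
  proof (intro sum.cong refl)
    fix l assume "l \<in> {..<m}"
    then show "A $$ (i, l) * B $$ (l, i) = (if l = i then A $$ (i, i) * B $$ (i, i) else 0)"
      using i zA[of l i] zB[of i l] by (cases l i rule: linorder_cases) auto
  qed
  finally show "(A * B) $$ (i, i) = A $$ (i, i) * B $$ (i, i)"
    using i by simp
qed

lemma upper_triangular_pow_mat:
  fixes A :: "'a :: semiring_1 mat"
  assumes A: "A \<in> carrier_mat m m" and ut: "upper_triangular A"
  shows "upper_triangular (A ^\<^sub>m k)" "i < m \<Longrightarrow> (A ^\<^sub>m k) $$ (i, i) = (A $$ (i, i)) ^ k"
proof (induction k)
  case (Suc k)
  case 1
  show ?case
    using upper_triangular_mult(1)[OF pow_carrier_mat[OF A] A Suc(1) ut] by simp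
  case 2
  then show ?case
    using upper_triangular_mult(2)[OF pow_carrier_mat[OF A] A Suc(1) ut] Suc(2)
    by (simp only: pow_mat.simps power_Suc2)
qed (use A in auto)

text \<open>In a Schur form with diagonal \<open>es\<close>, powers act entrywise on the diagonal.
  The geometric sum is therefore triangular with the scalar geometric sums on its diagonal.\<close>

lemma det_geom_mat:
  fixes A :: "complex mat"
  assumes A: "A \<in> carrier_mat m m" and cp: "char_poly A = (\<Prod>e\<leftarrow>es. [:- e, 1:])"
  shows "det (geom_mat n A) = (\<Prod>e\<leftarrow>es. \<Sum>k\<le>n. e ^ k)"
proof -
  obtain B P Q where "schur_decomposition A es = (B, P, Q)"
    by (metis prod_cases3)
  from schur_decomposition[OF A cp this]
  have sim: "similar_mat_wit A B P Q" and ut: "upper_triangular B" and es: "diag_mat B = es"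
    by auto
  have B: "B \<in> carrier_mat m m"
    using similar_mat_witD2[OF A sim] by simp
  have "det (geom_mat n A) = det (geom_mat n B)"
    using similar_mat_wit_geom_mat[OF A sim] by (intro det_similar) (auto simp: similar_mat_def)
  also have "\<dots> = prod_list (diag_mat (geom_mat n B))"
  proof (rule det_upper_triangular)
    show "upper_triangular (geom_mat n B)"
    proof (rule upper_triangularI)
      fix i j assume "j < i" "i < dim_row (geom_mat n B)"
      then have ij: "j < i" "i < m" using geom_mat_carrier[OF B, of n] by auto
      have "(B ^\<^sub>m k) $$ (i, j) = 0" for k
        using upper_triangular_pow_mat(1)[OF B ut, of k] ij B by auto
      then show "geom_mat n B $$ (i, j) = 0"
        using ij by (simp add: index_geom_mat[OF B])
    qed
  qed (rule geom_mat_carrier[OF B])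
  also have "diag_mat (geom_mat n B) = map (\<lambda>e. \<Sum>k\<le>n. e ^ k) (diag_mat B)"
    using carrier_matD(1)[OF B] carrier_matD(1)[OF geom_mat_carrier[OF B, of n]]
    by (simp add: diag_mat_def index_geom_mat[OF B] upper_triangular_pow_mat(2)[OF B ut])
  finally show ?thesis
    by (simp only: es)
qed

text \<open>For an eigenvector v and u = \<open>mat_adjoint A *\<^sub>v v\<close>, pairing the
  eigenvalue equation with v gives e |v|^2 = |u|^2. Hence \<open>Re\<close> and \<open>sqrt\<close>
  in \<open>singular_values\<close> lose no information.\<close>

lemma eigenvalue_mult_mat_adjoint:
  fixes A :: "complex mat"
  assumes A: "A \<in> carrier_mat r c" and ev: "eigenvalue (A * mat_adjoint A) e"
  shows "\<exists>x\<ge>0. e = complex_of_real x"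
proof -
  obtain v where v: "v \<in> carrier_vec r" "v \<noteq> 0\<^sub>v r"
    and eq: "(A * mat_adjoint A) *\<^sub>v v = e \<cdot>\<^sub>v v"
    using ev A by (auto simp: eigenvalue_def eigenvector_def)
  define u where "u = mat_adjoint A *\<^sub>v v"
  have u: "u \<in> carrier_vec c" using A v by (auto simp: u_def intro!: mult_mat_vec_carrier[of _ c r])
  have Au: "A *\<^sub>v u = e \<cdot>\<^sub>v v"
    using A v by (simp add: u_def eq[symmetric] assoc_mult_mat_vec[of _ r c _ r])
  have Aui: "(\<Sum>j<c. A $$ (i, j) * u $ j) = e * v $ i" if "i < r" for i
    using arg_cong[OF Au, of "\<lambda>w. w $ i"] A u v that
    by (simp add: scalar_prod_def atLeast0LessThan)
  have uj: "cnj (u $ j) = (\<Sum>i<r. A $$ (i, j) * cnj (v $ i))" if "j < c" for j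
    using A v that by (simp add: u_def scalar_prod_def atLeast0LessThan)
  define a where "a = (\<Sum>i<r. (cmod (v $ i))\<^sup>2)"
  define b where "b = (\<Sum>j<c. (cmod (u $ j))\<^sup>2)"
  have "e * of_real a = (\<Sum>i<r. (e * v $ i) * cnj (v $ i))"
    by (simp add: a_def complex_norm_square sum_distrib_left mult.assoc del: of_real_power)
  also have "\<dots> = (\<Sum>i<r. \<Sum>j<c. (A $$ (i, j) * u $ j) * cnj (v $ i))"
    by (simp add: Aui[symmetric] sum_distrib_right)
  \<comment> \<open>Summing over i first recognises the conjugate of \<open>u $ j\<close>.\<close>
  also have "\<dots> = (\<Sum>j<c. u $ j * cnj (u $ j))"
    by (subst sum.swap) (simp add: uj sum_distrib_left mult_ac)
  also have "\<dots> = of_real b"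
    by (simp add: b_def complex_norm_square del: of_real_power)
  finally have e: "e * of_real a = of_real b" .
  obtain i where i: "i < r" "v $ i \<noteq> 0"
  proof -
    have "\<exists>i<r. v $ i \<noteq> 0"
    proof (rule ccontr)
      assume "\<not> (\<exists>i<r. v $ i \<noteq> 0)"
      then have "v = 0\<^sub>v r" using v(1) by (intro eq_vecI) auto
      with v(2) show False by simp
    qed
    then show ?thesis using that by blast
  qed
  have "a > 0"
    unfolding a_def using i by (intro sum_pos2[of _ i]) auto
  then have "e = of_real (b / a)"
    using e by (simp add: field_simps)
  moreover have "b / a \<ge> 0"
    using \<open>a > 0\<close> by (simp add: b_def sum_nonneg)
  ultimately show ?thesis by blast
qed

section \<open>Factorisation of \<open>block_M\<close> and the determinant of
  \<open>block_A\<close>\<close>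

lemma sum_lessThan_mult_blocks:
  fixes f :: "nat \<Rightarrow> 'a :: comm_monoid_add"
  shows "(\<Sum>l<m * n. f l) = (\<Sum>q<n. \<Sum>t<m. f (q * m + t))"
proof -
  have "(\<Sum>l<m * n. f l) = (\<Sum>q<n. sum f {q * m..<q * m + m})"
    by (simp add: sum.nat_group mult.commute)
  moreover have "sum f {q * m..<q * m + m} = (\<Sum>t<m. f (q * m + t))" for q
    using sum.shift_bounds_nat_ivl[of f 0 "q * m" m]
    by (simp add: atLeast0LessThan add.commute)
  ultimately show ?thesis by simp
qed

definition block_T :: "nat \<Rightarrow> nat \<Rightarrow> complex mat \<Rightarrow> complex mat" where
  "block_T n m W = mat (m * n) (m * n) (\<lambda>(i, j).
     if j div m = i div m then 1\<^sub>m m $$ (i mod m, j mod m)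
     else if j div m = i div m + 1 then W $$ (i mod m, j mod m)
     else 0)"

text \<open>The solution \<open>C\<close> of \<open>T C = b\<close>, where \<open>T\<close> is \<^const>\<open>block_T\<close> and \<open>b\<close> is the last
  block column of \<^const>\<open>block_M\<close>, found by back substitution: block row \<open>p\<close> (0-based) of \<open>C\<close>
  is \<open>- (- W)^(n - p)\<close>. Hence \<open>M = T [I | C]\<close>.\<close>

definition block_C :: "nat \<Rightarrow> nat \<Rightarrow> complex mat \<Rightarrow> complex mat" where
  "block_C n m W = mat (m * n) m (\<lambda>(i, j). - (((- W) ^\<^sub>m (n - i div m)) $$ (i mod m, j)))"

definition block_E :: "nat \<Rightarrow> nat \<Rightarrow> complex mat \<Rightarrow> complex mat" where
  "block_E n m W = mat (m * n) (m * (n + 1)) (\<lambda>(i, j).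
     if j < m * n then 1\<^sub>m (m * n) $$ (i, j) else block_C n m W $$ (i, j - m * n))"

lemma block_carrier [simp]:
  "block_T n m W \<in> carrier_mat (m * n) (m * n)"
  "block_C n m W \<in> carrier_mat (m * n) m"
  "block_E n m W \<in> carrier_mat (m * n) (m * (n + 1))"
  by (simp_all add: block_T_def block_C_def block_E_def)

lemma block_index_less:
  fixes q n t m :: nat
  assumes "q < n" "t < m"
  shows "q * m + t < m * n"
proof -
  have "q * m + t < Suc q * m" using assms by simp
  also have "\<dots> \<le> n * m" using assms by (intro mult_le_mono1) simp
  finally show ?thesis by (simp add: mult.commute)
qed

text \<open>On the first m n columns \<open>block_E\<close> is the identity. In the last block
  column, with X = -W, block row p of the product is -X^(n-p) + W (-X^(n-p-1)), and the two terms
  cancel. The exception is p = n - 1, where the second term is absent and -X = W remains.\<close>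

lemma block_M_eq_mult:
  assumes W: "W \<in> carrier_mat m m"
  shows "block_M n m W = block_T n m W * block_E n m W"
proof (rule eq_matI)
  fix i j assume "i < dim_row (block_T n m W * block_E n m W)"
    "j < dim_col (block_T n m W * block_E n m W)"
  then have i: "i < m * n" and j: "j < m * (n + 1)"
    by (simp_all add: block_T_def block_E_def)
  have m: "m > 0" using i by (cases m) auto
  let ?X = "- W"
  have X: "?X \<in> carrier_mat m m" using W by simp
  have prod: "(block_T n m W * block_E n m W) $$ (i, j)
      = (\<Sum>l<m * n. block_T n m W $$ (i, l) * block_E n m W $$ (l, j))"
    by (rule index_mult_mat_sum[OF block_carrier(1,3) i j])
  show "block_M n m W $$ (i, j) = (block_T n m W * block_E n m W) $$ (i, j)"
  proof (cases "j < m * n")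
    case True
    have "(\<Sum>l<m * n. block_T n m W $$ (i, l) * block_E n m W $$ (l, j))
        = (\<Sum>l<m * n. if l = j then block_T n m W $$ (i, j) else 0)"
      using True j by (intro sum.cong) (auto simp: block_E_def)
    also have "\<dots> = block_M n m W $$ (i, j)"
      using True i j by (simp add: block_T_def block_M_def)
    finally show ?thesis by (simp add: prod)
  next
    case False
    define p r s where "p = i div m" and "r = i mod m" and "s = j - m * n"
    have s: "s < m" and r: "r < m" and p: "p < n"
      using False j m i by (auto simp: s_def r_def p_def less_mult_imp_div_less mult.commute)
    have j_eq: "j = n * m + s"
      using False by (simp add: s_def mult.commute)
    \<comment> \<open>Contribution of block q to entry (i, j): block row p of T is nonzero only in
      the blocks p and p + 1.\<close>
    have inner: "(\<Sum>t<m. block_T n m W $$ (i, q * m + t) * block_E n m W $$ (q * m + t, j))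
        = (if q = p then - ((?X ^\<^sub>m (n - p)) $$ (r, s)) else 0)
          + (if q = p + 1 then (?X ^\<^sub>m (n - p)) $$ (r, s) else 0)" if q: "q < n" for q
    proof -
      have E: "block_E n m W $$ (q * m + t, j) = - ((?X ^\<^sub>m (n - q)) $$ (t, s))" if "t < m" for t
        using block_index_less[OF q that] False j s that
        by (simp add: block_E_def block_C_def s_def[symmetric])
      have T: "block_T n m W $$ (i, q * m + t) =
          (if q = p then if r = t then 1 else 0 else if q = p + 1 then W $$ (r, t) else 0)"
        if "t < m" for t
      proof -
        define l where "l = q * m + t"
        have "l div m = q" "l mod m = t" "l < m * n"
          using that block_index_less[OF q that] by (simp_all add: l_def)
        then show ?thesis
          unfolding l_def[symmetric] using i r that
          by (simp add: block_T_def p_def[symmetric] r_def[symmetric])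
      qed
      consider "q = p" | "q = p + 1" | "q \<noteq> p" "q \<noteq> p + 1" by blast
      then show ?thesis
      proof cases
        case 1
        have "(\<Sum>t<m. block_T n m W $$ (i, q * m + t) * block_E n m W $$ (q * m + t, j))
            = (\<Sum>t<m. if t = r then - ((?X ^\<^sub>m (n - p)) $$ (r, s)) else 0)"
          unfolding 1 by (intro sum.cong) (auto simp: E[unfolded 1] T[unfolded 1])
        then show ?thesis using 1 r by simp
      next
        case 2
        have T2: "block_T n m W $$ (i, q * m + t) = W $$ (r, t)" if "t < m" for t
          using T[OF that] 2 by simp
        have "(\<Sum>t<m. block_T n m W $$ (i, q * m + t) * block_E n m W $$ (q * m + t, j))
            = (\<Sum>t<m. ?X $$ (r, t) * (?X ^\<^sub>m (n - q)) $$ (t, s))"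
          using r W by (intro sum.cong) (auto simp: E T2)
        also have "\<dots> = (?X * ?X ^\<^sub>m (n - q)) $$ (r, s)"
          using X r s by (intro index_mult_mat_sum[symmetric]) auto
        also have "?X * ?X ^\<^sub>m (n - q) = ?X ^\<^sub>m Suc (n - q)"
          by (rule pow_mat_Suc_left[OF X, symmetric])
        also have "Suc (n - q) = n - p" using 2 q by simp
        finally show ?thesis using 2 by simp
      next
        case 3
        then show ?thesis by (simp add: T)
      qed
    qed
    have "(\<Sum>l<m * n. block_T n m W $$ (i, l) * block_E n m W $$ (l, j))
        = (\<Sum>q<n. (if q = p then - ((?X ^\<^sub>m (n - p)) $$ (r, s)) else 0)
          + (if q = p + 1 then (?X ^\<^sub>m (n - p)) $$ (r, s) else 0))"
      unfolding sum_lessThan_mult_blocks by (intro sum.cong refl inner) simp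
    also have "\<dots> = - ((?X ^\<^sub>m (n - p)) $$ (r, s))
        + (if p + 1 < n then (?X ^\<^sub>m (n - p)) $$ (r, s) else 0)"
      using p by (simp add: sum.distrib)
    \<comment> \<open>If p + 1 = n there is no block q = p + 1 to cancel against, and the exponent n
      - p is 1.\<close>
    also have "\<dots> = (if n = p + 1 then W $$ (r, s) else 0)"
    proof (cases "n = p + 1")
      case True
      then show ?thesis using W X r s by simp
    qed (use p in auto)
    also have "\<dots> = block_M n m W $$ (i, j)"
    proof -
      have "j div m = n" "j mod m = s" using s by (simp_all add: j_eq)
      then show ?thesis
        using i j p by (simp add: block_M_def p_def[symmetric] r_def[symmetric])
    qed
    finally show ?thesis by (simp add: prod)
  qed
qed (simp_all add: block_M_def block_T_def block_E_def)

text \<open>The blocks \<open>W\<close> lie above the identity blocks of the diagonal, so T is upper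
  and its adjoint lower triangular, both with unit diagonal.\<close>

lemma det_block_T: "det (block_T n m W) = 1" and
  det_mat_adjoint_block_T: "det (mat_adjoint (block_T n m W)) = 1"
proof -
  have diag: "block_T n m W $$ (i, i) = 1" if "i < m * n" for i
  proof -
    have "m > 0" using that by (cases m) auto
    then show ?thesis using that by (simp add: block_T_def)
  qed
  have low: "block_T n m W $$ (i, j) = 0" if "j < i" "i < m * n" for i j
  proof -
    have m: "m > 0" using that by (cases m) auto
    have "j div m \<le> i div m" using that by (intro div_le_mono) simp
    \<comment> \<open>Within a diagonal block, distinct indices differ in their offsets, so the
      identity block contributes zero.\<close>
    moreover have "i mod m \<noteq> j mod m" if "j div m = i div m"
      using that \<open>j < i\<close> by (metis div_mult_mod_eq less_irrefl)
    ultimately show ?thesis using that m by (auto simp: block_T_def)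
  qed
  have dim: "dim_row (block_T n m W) = m * n" "dim_col (block_T n m W) = m * n"
    by (simp_all add: block_T_def)
  have "det (block_T n m W) = prod_list (diag_mat (block_T n m W))"
    by (rule det_upper_triangular[of _ "m * n"]) (auto simp: dim low)
  then show "det (block_T n m W) = 1"
    by (simp add: prod_list_diag_prod dim diag)
  have "det (mat_adjoint (block_T n m W)) = prod_list (diag_mat (mat_adjoint (block_T n m W)))"
    by (rule det_lower_triangular[of "m * n"]) (auto simp: dim low)
  then show "det (mat_adjoint (block_T n m W)) = 1"
    by (simp add: prod_list_diag_prod dim diag)
qed

lemma block_E_mult_adjoint:
  "block_E n m W * mat_adjoint (block_E n m W)
    = 1\<^sub>m (m * n) + block_C n m W * mat_adjoint (block_C n m W)"
proof (rule eq_matI)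
  let ?E = "block_E n m W" and ?C = "block_C n m W"
  have dim: "dim_row ?E = m * n" "dim_col ?E = m * (n + 1)" "dim_row ?C = m * n" "dim_col ?C = m"
    by (simp_all add: block_E_def block_C_def)
  fix i j assume "i < dim_row (1\<^sub>m (m * n) + ?C * mat_adjoint ?C)"
    "j < dim_col (1\<^sub>m (m * n) + ?C * mat_adjoint ?C)"
  then have i: "i < m * n" and j: "j < m * n" by (simp_all add: dim)
  have split: "(\<Sum>l<a + b. f l) = (\<Sum>l<a. f l) + (\<Sum>t<b. f (a + t))"
    for a b :: nat and f :: "nat \<Rightarrow> complex"
    by (induction b) (simp_all add: add.assoc)
  have "(?E * mat_adjoint ?E) $$ (i, j) = (\<Sum>l<m * (n + 1). ?E $$ (i, l) * mat_adjoint ?E $$ (l, j))"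
    using i j by (intro index_mult_mat_sum) (auto simp: dim)
  \<comment> \<open>Splitting the columns at m n separates the identity part of [I | C] from the
    part C.\<close>
  also have "\<dots> = (\<Sum>l<m * n + m. ?E $$ (i, l) * cnj (?E $$ (j, l)))"
    using i j by (intro sum.cong) (auto simp: dim)
  also have "\<dots> = (\<Sum>l<m * n. ?E $$ (i, l) * cnj (?E $$ (j, l)))
      + (\<Sum>t<m. ?E $$ (i, m * n + t) * cnj (?E $$ (j, m * n + t)))"
    by (rule split)
  also have "(\<Sum>l<m * n. ?E $$ (i, l) * cnj (?E $$ (j, l)))
      = (\<Sum>l<m * n. if l = i then 1\<^sub>m (m * n) $$ (i, j) else 0)"
    using i j by (intro sum.cong) (auto simp: block_E_def)
  also have "\<dots> = 1\<^sub>m (m * n) $$ (i, j)" using i by simp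
  also have "(\<Sum>t<m. ?E $$ (i, m * n + t) * cnj (?E $$ (j, m * n + t)))
      = (\<Sum>t<m. ?C $$ (i, t) * mat_adjoint ?C $$ (t, j))"
    using i j by (intro sum.cong) (auto simp: block_E_def dim)
  also have "\<dots> = (?C * mat_adjoint ?C) $$ (i, j)"
    using i j by (intro index_mult_mat_sum[symmetric]) (auto simp: dim)
  finally show "(?E * mat_adjoint ?E) $$ (i, j) = (1\<^sub>m (m * n) + ?C * mat_adjoint ?C) $$ (i, j)"
    using i j by (simp add: dim)
qed (simp_all add: block_E_def block_C_def)

text \<open>Each block of C is, up to sign, a Hermitian power of -W. It therefore contributes its
  own square, which is a power of \<open>W * mat_adjoint W\<close>. The exponents run from n down to
  1, and the identity supplies exponent 0.\<close>

lemma adjoint_block_C_mult: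
  assumes W: "W \<in> carrier_mat m m" and h: "mat_adjoint W = W"
  shows "1\<^sub>m m + mat_adjoint (block_C n m W) * block_C n m W = geom_mat n (W * mat_adjoint W)"
proof (rule eq_matI)
  let ?C = "block_C n m W" and ?X = "- W"
  have dim: "dim_row ?C = m * n" "dim_col ?C = m" by (simp_all add: block_C_def)
  have X: "?X \<in> carrier_mat m m" using W by simp
  have Q: "W * mat_adjoint W \<in> carrier_mat m m" using W h by simp
  have hX: "mat_adjoint ?X = ?X"
  proof (rule eq_matI)
    fix i j assume ij: "i < dim_row ?X" "j < dim_col ?X"
    then have "cnj (W $$ (j, i)) = W $$ (i, j)"
      using W arg_cong[OF h, of "\<lambda>A. A $$ (i, j)"] by simp
    then show "mat_adjoint ?X $$ (i, j) = ?X $$ (i, j)" using W ij by simp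
  qed (use W in auto)
  \<comment> \<open>The signs cancel. The square of \<open>W\<close> is written with the adjoint
    because \<open>singular_values\<close> is defined through that product.\<close>
  have XX: "?X * ?X = W * mat_adjoint W"
    using W by (simp add: h)
  have dimG: "dim_row (geom_mat n (W * mat_adjoint W)) = m" "dim_col (geom_mat n (W * mat_adjoint W)) = m"
    using geom_mat_carrier[OF Q] by auto
  show "dim_row (1\<^sub>m m + mat_adjoint ?C * ?C) = dim_row (geom_mat n (W * mat_adjoint W))"
    "dim_col (1\<^sub>m m + mat_adjoint ?C * ?C) = dim_col (geom_mat n (W * mat_adjoint W))"
    by (simp_all add: dim dimG)
  fix i j assume "i < dim_row (geom_mat n (W * mat_adjoint W))"
    "j < dim_col (geom_mat n (W * mat_adjoint W))"
  then have i: "i < m" and j: "j < m" by (simp_all add: dimG)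
  have "(mat_adjoint ?C * ?C) $$ (i, j) = (\<Sum>l<m * n. mat_adjoint ?C $$ (i, l) * ?C $$ (l, j))"
    using i j by (intro index_mult_mat_sum) (auto simp: dim)
  also have "\<dots> = (\<Sum>q<n. \<Sum>t<m. mat_adjoint ?C $$ (i, q * m + t) * ?C $$ (q * m + t, j))"
    by (rule sum_lessThan_mult_blocks)
  also have "\<dots> = (\<Sum>q<n. ((W * mat_adjoint W) ^\<^sub>m (n - q)) $$ (i, j))"
  proof (intro sum.cong refl)
    fix q assume "q \<in> {..<n}"
    then have q: "q < n" by simp
    define Y where "Y = ?X ^\<^sub>m (n - q)"
    have Y: "Y \<in> carrier_mat m m" "mat_adjoint Y = Y"
      using X mat_adjoint_pow_mat[OF X hX] by (auto simp: Y_def)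
    have "(\<Sum>t<m. mat_adjoint ?C $$ (i, q * m + t) * ?C $$ (q * m + t, j))
        = (\<Sum>t<m. mat_adjoint Y $$ (i, t) * Y $$ (t, j))"
    proof (intro sum.cong refl)
      fix t assume "t \<in> {..<m}"
      then have t: "t < m" by simp
      show "mat_adjoint ?C $$ (i, q * m + t) * ?C $$ (q * m + t, j) = mat_adjoint Y $$ (i, t) * Y $$ (t, j)"
        using block_index_less[OF q t] t i j Y(1)
        by (simp add: dim) (simp add: block_C_def Y_def)
    qed
    also have "\<dots> = (Y * Y) $$ (i, j)"
      unfolding Y(2) using Y(1) i j by (intro index_mult_mat_sum[symmetric]) auto
    also have "Y * Y = (W * mat_adjoint W) ^\<^sub>m (n - q)"
      unfolding Y_def pow_mat_mult_pow_mat_same[OF X] XX ..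
    finally show "(\<Sum>t<m. mat_adjoint ?C $$ (i, q * m + t) * ?C $$ (q * m + t, j))
      = ((W * mat_adjoint W) ^\<^sub>m (n - q)) $$ (i, j)" .
  qed
  \<comment> \<open>Reversal of the order of summation: k = n - Suc q turns the exponent n - q into
    \<open>Suc k\<close>.\<close>
  also have "\<dots> = (\<Sum>k<n. ((W * mat_adjoint W) ^\<^sub>m Suc k) $$ (i, j))"
    by (rule sum.reindex_bij_witness[of _ "\<lambda>k. n - Suc k" "\<lambda>q. n - Suc q"])
       (auto simp: Suc_diff_Suc simp del: pow_mat.simps)
  finally have "(1\<^sub>m m + mat_adjoint ?C * ?C) $$ (i, j)
      = ((W * mat_adjoint W) ^\<^sub>m 0) $$ (i, j) + (\<Sum>k<n. ((W * mat_adjoint W) ^\<^sub>m Suc k) $$ (i, j))"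
    using i j W by (simp add: dim del: pow_mat.simps(2))
  also have "\<dots> = geom_mat n (W * mat_adjoint W) $$ (i, j)"
    unfolding index_geom_mat[OF Q i j] by (simp only: sum.atMost_shift)
  finally show "(1\<^sub>m m + mat_adjoint ?C * ?C) $$ (i, j) = geom_mat n (W * mat_adjoint W) $$ (i, j)" .
qed

text \<open>The matrix is T F times the adjoint of T, with outer determinants 1. Sylvester's
  identity then reduces \<open>det F\<close> from size m n to size m.\<close>

lemma det_block_A:
  assumes W: "W \<in> carrier_mat m m" and h: "mat_adjoint W = W"
  shows "det (block_A n m W) = det (geom_mat n (W * mat_adjoint W))"
proof -
  let ?T = "block_T n m W" and ?E = "block_E n m W" and ?C = "block_C n m W"
  define F where "F = ?E * mat_adjoint ?E"
  have c: "?T \<in> carrier_mat (m * n) (m * n)" "mat_adjoint ?T \<in> carrier_mat (m * n) (m * n)"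
    "?E \<in> carrier_mat (m * n) (m * (n + 1))" "mat_adjoint ?E \<in> carrier_mat (m * (n + 1)) (m * n)"
    by (intro block_carrier mat_adjoint_carrier)+
  have F: "F \<in> carrier_mat (m * n) (m * n)"
    unfolding F_def using c(3,4) by (rule mult_carrier_mat)
  have "block_A n m W = (?T * ?E) * (mat_adjoint ?E * mat_adjoint ?T)"
    unfolding block_A_def block_M_eq_mult[OF W] by (simp only: mat_adjoint_mult[OF c(1,3)])
  also have "\<dots> = ?T * (?E * (mat_adjoint ?E * mat_adjoint ?T))"
    by (rule assoc_mult_mat[OF c(1,3) mult_carrier_mat[OF c(4,2)]])
  also have "?E * (mat_adjoint ?E * mat_adjoint ?T) = F * mat_adjoint ?T"
    unfolding F_def by (rule assoc_mult_mat[OF c(3,4,2), symmetric])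
  finally have "det (block_A n m W) = det F"
    by (simp only: det_mult[OF c(1) mult_carrier_mat[OF F c(2)]] det_mult[OF F c(2)]
        det_block_T det_mat_adjoint_block_T mult_1 mult_1_right)
  also have "\<dots> = det (1\<^sub>m m + mat_adjoint ?C * ?C)"
    unfolding F_def block_E_mult_adjoint
    by (rule det_one_plus_mult_commute[OF block_carrier(2) mat_adjoint_carrier[OF block_carrier(2)]])
  finally show ?thesis
    by (simp only: adjoint_block_C_mult[OF W h])
qed

section \<open>Singular values and the final estimates\<close>

lemma set_singular_values:
  "set (singular_values A) = {sqrt (Re e) | e. eigenvalue (A * mat_adjoint A) e}"
proof -
  let ?Q = "A * mat_adjoint A"
  have Q: "?Q \<in> carrier_mat (dim_row A) (dim_row A)" by (intro carrier_matI) simp_all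
  \<comment> \<open>For a nonzero polynomial the elements of \<open>proots\<close> are exactly the
    roots.\<close>
  have "char_poly ?Q \<noteq> 0"
    using degree_monic_char_poly[OF Q] by auto
  then show ?thesis
    by (auto simp: singular_values_def eigenvalue_root_char_poly[OF Q])
qed

lemma singular_value_image: "singular_value A ` {1..dim_row A} = set (singular_values A)"
proof -
  \<comment> \<open>Aligns the 1-based index of \<open>singular_value\<close> with 0-based list
    positions.\<close>
  have "{1..dim_row A} = Suc ` {..<dim_row A}"
    by (simp add: lessThan_atLeast0 image_Suc_atLeastLessThan atLeastLessThanSuc_atLeastAtMost)
  then show ?thesis
    by (simp only: image_image singular_value_def diff_Suc_1)
       (auto simp: set_conv_nth length_singular_values)
qed

lemma norm_prod_list_le_power:
  fixes f :: "'b \<Rightarrow> 'a :: real_normed_div_algebra"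
  assumes "\<And>x. x \<in> set xs \<Longrightarrow> norm (f x) \<le> c"
  shows "norm (\<Prod>x\<leftarrow>xs. f x) \<le> c ^ length xs"
  using assms
proof (induction xs)
  case (Cons x xs)
  have "norm (f x) * norm (\<Prod>x\<leftarrow>xs. f x) \<le> c * c ^ length xs"
    \<comment> \<open>That c is nonnegative follows from the bound at the head
      \<open>x\<close>.\<close>
    using Cons by (intro mult_mono) (auto intro: order.trans[OF norm_ge_zero])
  then show ?case by (simp add: norm_mult)
qed simp

text \<open>Common to both cases of the theorem: the determinant is a product of m scalar geometric
  sums, so a uniform bound c on each of them suffices.\<close>

lemma sqrt_cmod_det_block_A_le:
  assumes W: "W \<in> carrier_mat m m" and h: "mat_adjoint W = W"
    and bound: "\<And>s. s \<in> set (singular_values W) \<Longrightarrow> s \<ge> 0 \<Longrightarrow> (\<Sum>k\<le>n. (s\<^sup>2) ^ k) \<le> c"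
  shows "sqrt (cmod (det (block_A n m W))) \<le> sqrt c ^ m"
proof -
  let ?Q = "W * mat_adjoint W"
  have Q: "?Q \<in> carrier_mat m m" using W h by simp
  obtain es where cp: "char_poly ?Q = (\<Prod>e\<leftarrow>es. [:- e, 1:])" and len: "length es = m"
    using char_poly_factorized[OF Q] by auto
  have "cmod (\<Sum>k\<le>n. e ^ k) \<le> c" if "e \<in> set es" for e
  proof -
    have "poly (char_poly ?Q) e = 0"
      unfolding cp poly_prod_list using that by (force simp: prod_list_zero_iff)
    then have ev: "eigenvalue ?Q e"
      by (simp add: eigenvalue_root_char_poly[OF Q])
    then obtain x where x: "x \<ge> 0" "e = complex_of_real x"
      using eigenvalue_mult_mat_adjoint[OF W] by blast
    \<comment> \<open>The singular value belonging to e is s = \<open>sqrt x\<close>, so that s^2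
      recovers x.\<close>
    have "sqrt x \<in> set (singular_values W)"
      using ev x unfolding set_singular_values by (intro CollectI exI[of _ e]) simp
    then have "(\<Sum>k\<le>n. ((sqrt x)\<^sup>2) ^ k) \<le> c"
      using x by (intro bound) auto
    moreover have "(\<Sum>k\<le>n. e ^ k) = complex_of_real (\<Sum>k\<le>n. x ^ k)"
      by (simp add: x)
    then have "cmod (\<Sum>k\<le>n. e ^ k) = (\<Sum>k\<le>n. x ^ k)"
      using x by (simp only: norm_of_real) (simp add: sum_nonneg)
    ultimately show ?thesis using x by simp
  qed
  then have "cmod (\<Prod>e\<leftarrow>es. \<Sum>k\<le>n. e ^ k) \<le> c ^ length es"
    by (rule norm_prod_list_le_power)
  then have "cmod (det (block_A n m W)) \<le> c ^ m"
    by (simp only: det_block_A[OF W h] det_geom_mat[OF Q cp] len)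
  then show ?thesis
    by (metis real_sqrt_le_mono real_sqrt_power)
qed

theorem proposition3p12:
  fixes n m :: nat and W :: "complex mat"
  assumes "n \<ge> 1" and "m \<ge> 1"
    and "W \<in> carrier_mat m m" and "hermitian_mat W"
    and "sigma_max W \<le> 1"
  shows "gen_det (block_M n m W) = sqrt (cmod (det (block_A n m W)))
    \<and> sqrt (cmod (det (block_A n m W))) \<le>
      (if sigma_max W < 1
         then (1 / sqrt (MIN j\<in>{1..m}. 1 - (singular_value W j)\<^sup>2)) ^ m
       else if sigma_max W = 1 then (sqrt (real n + 1)) ^ m
       else real n powr (real m / 2) * sigma_max W ^ (n * m))"
proof
  show "gen_det (block_M n m W) = sqrt (cmod (det (block_A n m W)))"
    by (simp add: gen_det_def block_A_def)
  let ?S = "set (singular_values W)"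
  have W: "W \<in> carrier_mat m m" and h: "mat_adjoint W = W"
    using assms by (auto simp: hermitian_mat_def)
  have S: "singular_value W ` {1..m} = ?S"
    using singular_value_image[of W] W by simp
  have max: "sigma_max W = Max ?S"
    using W S by (simp add: sigma_max_def)
  have le: "s \<le> sigma_max W" if "s \<in> ?S" for s
    using that by (simp add: max)
  \<comment> \<open>The bound on \<open>sigma_max W\<close> leaves exactly these two cases.\<close>
  consider "sigma_max W < 1" | "sigma_max W = 1"
    using assms by linarith
  then show "sqrt (cmod (det (block_A n m W))) \<le>
      (if sigma_max W < 1
         then (1 / sqrt (MIN j\<in>{1..m}. 1 - (singular_value W j)\<^sup>2)) ^ m
       else if sigma_max W = 1 then (sqrt (real n + 1)) ^ m
       else real n powr (real m / 2) * sigma_max W ^ (n * m))"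
  proof cases
    case 1
    define d where "d = (MIN j\<in>{1..m}. 1 - (singular_value W j)\<^sup>2)"
    have d_eq: "d = Min ((\<lambda>s. 1 - s\<^sup>2) ` ?S)"
      by (simp add: d_def S[symmetric] image_image)
    have ne: "?S \<noteq> {}"
      using assms(2) by (simp add: S[symmetric])
    have nonneg: "s \<ge> 0" if "s \<in> ?S" for s
      using that eigenvalue_mult_mat_adjoint[OF W] by (fastforce simp: set_singular_values)
    \<comment> \<open>The minimum is attained at some singular value s0 < 1, which makes d
      positive.\<close>
    have "d \<in> (\<lambda>s. 1 - s\<^sup>2) ` ?S"
      unfolding d_eq using ne by (intro Min_in) auto
    then obtain s0 where s0: "s0 \<in> ?S" "d = 1 - s0\<^sup>2" by blast
    have "s0\<^sup>2 < 1"
      using nonneg[OF s0(1)] le[OF s0(1)] 1 by (simp add: abs_square_less_1)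
    then have d: "d > 0" by (simp add: s0(2))
    have "sqrt (cmod (det (block_A n m W))) \<le> sqrt (1 / d) ^ m"
    proof (rule sqrt_cmod_det_block_A_le[OF W h])
      fix s assume s: "s \<in> ?S" "s \<ge> 0"
      have ds: "d \<le> 1 - s\<^sup>2"
        unfolding d_eq using s by (intro Min_le) auto
      \<comment> \<open>Excludes the degenerate ratio 1 in the closed form of the geometric
        sum.\<close>
      then have "s\<^sup>2 \<noteq> 1" using d by auto
      then have "(\<Sum>k\<le>n. (s\<^sup>2) ^ k) = (1 - (s\<^sup>2) ^ Suc n) / (1 - s\<^sup>2)"
        by (simp add: sum_gp0)
      also have "\<dots> \<le> 1 / (1 - s\<^sup>2)"
        using ds d by (intro divide_right_mono) auto
      also have "\<dots> \<le> 1 / d"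
        using ds d by (intro divide_left_mono) auto
      finally show "(\<Sum>k\<le>n. (s\<^sup>2) ^ k) \<le> 1 / d" .
    qed
    then show ?thesis
      unfolding d_def[symmetric] using 1 by (simp add: real_sqrt_divide)
  next
    case 2
    have "sqrt (cmod (det (block_A n m W))) \<le> sqrt (real n + 1) ^ m"
    proof (rule sqrt_cmod_det_block_A_le[OF W h])
      fix s assume s: "s \<in> ?S" "s \<ge> 0"
      then have "s\<^sup>2 \<le> 1" using le[OF s(1)] 2 by (simp add: power_le_one)
      \<comment> \<open>Each of the n + 1 terms is at most 1.\<close>
      then have "(\<Sum>k\<le>n. (s\<^sup>2) ^ k) \<le> (\<Sum>k\<le>n. 1)"
        using s by (intro sum_mono power_le_one[of "s\<^sup>2"]) auto
      then show "(\<Sum>k\<le>n. (s\<^sup>2) ^ k) \<le> real n + 1" by simp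
    qed
    then show ?thesis using 2 by simp
  qed
qed

end
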